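(* Let $\{x_n\}_{n\ge 0}$ be a sequence in a metric space $(X,d)$ with $d(x_n,x_{n+1})\to 0$. Suppose that for every $\epsilon>0$ there exists a sequence $\{\nu_n\}_{n\ge 0}$ of nonnegative integers such that, for any two subsequences $\{x_{p_n}\}$ and $\{x_{q_n}\}$ of $\{x_n\}$, if $\limsup_{n\to\infty} d(x_{p_n},x_{q_n})\leq \epsilon$, then there is some $N$ with $$d(x_{p_n+\nu_n},x_{q_n+\nu_n})\leq \epsilon \qquad \text{for all } n\geq N.$$ Then $\{x_n\}$ is a Cauchy sequence.
   Context: All sequences are indexed by $\mathbb{N}_0=\{0,1,2,\dots\}$. A subsequence $\{x_{p_n}\}$ is given by a strictly increasing sequence $\{p_n\}$ of nonnegative integers. Limits superior are taken in $[0,\infty]$. *)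

theory Defs
  imports Complex_Main "HOL-Library.Extended_Nonnegative_Real"
begin

end

theory Submission imports Defs begin

text \<open>If the sequence is not Cauchy, fix \<open>\<epsilon>\<close> such that tails of arbitrarily large index
  contain pairs at distance more than \<open>\<epsilon>\<close>, and let \<open>\<nu>\<close> be the sequence belonging to \<open>\<epsilon>\<close>.
  Far out, choose \<open>a\<close> and then the least \<open>b > a\<close> with \<open>d(x_a, x_b) > \<epsilon>\<close>; this distance barely
  exceeds \<open>\<epsilon>\<close>, since consecutive terms are close. As \<open>\<nu>\<^sub>n\<close> is known before the pair is chosen,
  shifting both indices back by \<open>\<nu>\<^sub>n\<close> changes the distance by as little as desired. The shifted
  indices \<open>p\<^sub>n, q\<^sub>n\<close> contradict the hypothesis.\<close>

lemma dist_shift_le: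
  fixes x :: "nat \<Rightarrow> 'a::metric_space"
  assumes "\<And>j. j \<ge> J \<Longrightarrow> dist (x j) (x (Suc j)) \<le> \<delta>" and "i \<ge> J"
  shows "dist (x i) (x (i + v)) \<le> real v * \<delta>"
proof (induction v)
  case (Suc v)
  have "dist (x i) (x (i + Suc v)) \<le> dist (x i) (x (i + v)) + dist (x (i + v)) (x (Suc (i + v)))"
    by (simp add: dist_triangle)
  also have "\<dots> \<le> real v * \<delta> + \<delta>"
    using Suc assms(1)[of "i + v"] assms(2) by simp
  finally show ?case by (simp add: algebra_simps)
qed simp

text \<open>The pair at distance more than \<open>\<epsilon>\<close> is found first, as
  \<open>(a, b)\<close>, and the witnesses are \<open>p = a - v\<close>, \<open>q = b - v\<close>.
  The bound \<open>K\<close> lets later choices go beyond earlier ones.\<close>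

lemma ex_separated_after_shift:
  fixes x :: "nat \<Rightarrow> 'a::metric_space"
  assumes lim: "(\<lambda>n. dist (x n) (x (Suc n))) \<longlonglongrightarrow> 0"
    and sep: "\<And>M. \<exists>m\<ge>M. \<exists>n\<ge>M. dist (x m) (x n) > \<epsilon>"
    and "\<epsilon> > 0" "\<eta> > 0"
  shows "\<exists>p\<ge>K. \<exists>q\<ge>K. dist (x p) (x q) \<le> \<epsilon> + \<eta> \<and> dist (x (p + v)) (x (q + v)) > \<epsilon>"
proof -
  \<comment> \<open>The path from \<open>a - v\<close> via \<open>a\<close>, \<open>b - 1\<close>
    and \<open>b\<close> to \<open>b - v\<close> costs at most \<open>\<epsilon>\<close> between
    \<open>a\<close> and \<open>b - 1\<close>, plus \<open>2 * v + 1\<close> single steps, which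
    together must cost at most \<open>\<eta>\<close>.\<close>
  define \<delta> where "\<delta> = \<eta> / (2 * real v + 1)"
  have "\<delta> > 0" using \<open>\<eta> > 0\<close> by (simp add: \<delta>_def)
  then obtain J where J: "\<And>j. j \<ge> J \<Longrightarrow> dist (x j) (x (Suc j)) \<le> \<delta>"
    using LIMSEQ_D[OF lim, of \<delta>] by fastforce
  \<comment> \<open>The extra \<open>v\<close> keeps \<open>a - v\<close> and \<open>b - v\<close>
    above both \<open>J\<close> and \<open>K\<close>, and prevents truncated subtraction.\<close>
  define M where "M = max J K + v"
  obtain a c where ac: "a \<ge> M" "c > a" "dist (x a) (x c) > \<epsilon>"
  proof -
    obtain m n where mn: "m \<ge> M" "n \<ge> M" "dist (x m) (x n) > \<epsilon>" using sep by blast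
    then have "m \<noteq> n" using \<open>\<epsilon> > 0\<close> by auto
    then show ?thesis using that[of m n] that[of n m] mn by (cases "m < n") (auto simp: dist_commute)
  qed
  define b where "b = (LEAST c. c > a \<and> dist (x a) (x c) > \<epsilon>)"
  have b: "b > a" "dist (x a) (x b) > \<epsilon>"
    using LeastI[of "\<lambda>c. c > a \<and> dist (x a) (x c) > \<epsilon>" c] ac by (auto simp: b_def)
  \<comment> \<open>Minimality of \<open>b\<close> applies only if \<open>b - 1 > a\<close>; for
    \<open>b - 1 = a\<close> the distance is 0.\<close>
  have prev: "dist (x a) (x (b - 1)) \<le> \<epsilon>"
    using not_less_Least[of "b - 1" "\<lambda>c. c > a \<and> dist (x a) (x c) > \<epsilon>", folded b_def] b(1) \<open>\<epsilon> > 0\<close>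
    by (cases "b - 1 = a") auto
  have "M \<ge> v" "M - v \<ge> J" "M - v \<ge> K" by (auto simp: M_def)
  have "dist (x (a - v)) (x a) \<le> real v * \<delta>"
    using dist_shift_le[of J x \<delta> "a - v" v, OF J] ac \<open>M \<ge> v\<close> \<open>M - v \<ge> J\<close> by simp
  moreover have "dist (x (b - v)) (x b) \<le> real v * \<delta>"
    using dist_shift_le[of J x \<delta> "b - v" v, OF J] ac b \<open>M \<ge> v\<close> \<open>M - v \<ge> J\<close> by simp
  moreover have "dist (x (b - 1)) (x b) \<le> \<delta>"
    using J[of "b - 1"] b ac \<open>M - v \<ge> J\<close> by simp
  ultimately have "dist (x (a - v)) (x (b - v)) \<le> real v * \<delta> + \<epsilon> + \<delta> + real v * \<delta>"
    using prev dist_triangle[of "x (a - v)" "x (b - v)" "x a"]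
      dist_triangle[of "x a" "x (b - v)" "x (b - 1)"]
      dist_triangle[of "x (b - 1)" "x (b - v)" "x b"] dist_commute[of "x b" "x (b - v)"]
    by linarith
  also have "\<dots> = \<epsilon> + (2 * real v + 1) * \<delta>" by (simp add: algebra_simps)
  also have "(2 * real v + 1) * \<delta> = \<eta>" unfolding \<delta>_def by simp
  finally show ?thesis
    using ac b \<open>M \<ge> v\<close> \<open>M - v \<ge> K\<close> by (intro exI[of _ "a - v"] conjI exI[of _ "b - v"]) auto
qed

theorem lemma2p1:
  fixes x :: "nat \<Rightarrow> 'a::metric_space"
  assumes "(\<lambda>n. dist (x n) (x (Suc n))) \<longlonglongrightarrow> 0"
    and "\<And>\<epsilon>::real. \<epsilon> > 0 \<Longrightarrow>
      \<exists>\<nu> :: nat \<Rightarrow> nat. \<forall>p q :: nat \<Rightarrow> nat.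
        strict_mono p \<longrightarrow> strict_mono q \<longrightarrow>
        limsup (\<lambda>n. ennreal (dist (x (p n)) (x (q n)))) \<le> ennreal \<epsilon> \<longrightarrow>
        (\<exists>N. \<forall>n\<ge>N. dist (x (p n + \<nu> n)) (x (q n + \<nu> n)) \<le> \<epsilon>)"
  shows "Cauchy x"
proof (rule ccontr)
  assume "\<not> Cauchy x"
  then obtain e where "e > 0" and e: "\<And>M. \<exists>m\<ge>M. \<exists>n\<ge>M. dist (x m) (x n) \<ge> e"
    unfolding Cauchy_def by (meson not_less)
  \<comment> \<open>Failure of Cauchy only gives distances at least \<open>e\<close>; halving makes
    the inequality strict.\<close>
  define \<epsilon> where "\<epsilon> = e / 2"
  have "\<epsilon> > 0" "\<epsilon> < e" using \<open>e > 0\<close> by (auto simp: \<epsilon>_def)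
  have sep: "\<exists>m\<ge>M. \<exists>n\<ge>M. dist (x m) (x n) > \<epsilon>" for M
    using e[of M] \<open>\<epsilon> < e\<close> by (meson less_le_trans)
  obtain \<nu> :: "nat \<Rightarrow> nat" where \<nu>: "\<And>p q :: nat \<Rightarrow> nat. strict_mono p \<Longrightarrow> strict_mono q \<Longrightarrow>
        limsup (\<lambda>n. ennreal (dist (x (p n)) (x (q n)))) \<le> ennreal \<epsilon> \<Longrightarrow>
        \<exists>N. \<forall>n\<ge>N. dist (x (p n + \<nu> n)) (x (q n + \<nu> n)) \<le> \<epsilon>"
    using assms(2)[OF \<open>\<epsilon> > 0\<close>] by metis
  \<comment> \<open>The slack tends to 0, so the limsup stays at most \<open>\<epsilon>\<close>,
    while the second conjunct violates the conclusion for \<open>\<nu>\<close> at every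
    \<open>n\<close>.\<close>
  define P where "P n r \<longleftrightarrow> dist (x (fst r)) (x (snd r)) \<le> \<epsilon> + inverse (real (Suc n)) \<and>
    dist (x (fst r + \<nu> n)) (x (snd r + \<nu> n)) > \<epsilon>" for n and r :: "nat \<times> nat"
  have ex: "\<exists>r. P n r \<and> K \<le> fst r \<and> K \<le> snd r" for n K
    using ex_separated_after_shift[OF assms(1) sep \<open>\<epsilon> > 0\<close>, of "inverse (real (Suc n))" K "\<nu> n"]
    by (auto simp: P_def)
  obtain f where f: "\<And>n. P n (f n)"
    and step: "\<And>n. fst (f n) < fst (f (Suc n)) \<and> snd (f n) < snd (f (Suc n))"
  proof -
    have "\<exists>f. \<forall>n. P n (f n) \<and> (fst (f n) < fst (f (Suc n)) \<and> snd (f n) < snd (f (Suc n)))"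
    proof (rule dependent_nat_choice)
      show "\<exists>r. P 0 r" using ex by blast
      \<comment> \<open>Starting beyond both earlier coordinates makes both index sequences strictly
        increasing.\<close>
      show "\<exists>s. P (Suc n) s \<and> fst r < fst s \<and> snd r < snd s" for r n
        using ex[of "Suc n" "Suc (max (fst r) (snd r))"]
        by (meson Suc_le_eq le_less_trans max.cobounded1 max.cobounded2)
    qed
    then show ?thesis using that by blast
  qed
  have "(\<lambda>n. \<epsilon> + inverse (real (Suc n))) \<longlonglongrightarrow> \<epsilon>"
    using tendsto_add[OF tendsto_const LIMSEQ_inverse_real_of_nat] by simp
  then have "limsup (\<lambda>n. ennreal (\<epsilon> + inverse (real (Suc n)))) = ennreal \<epsilon>"
    by (intro lim_imp_Limsup tendsto_ennrealI) auto
  moreover have "limsup (\<lambda>n. ennreal (dist (x (fst (f n))) (x (snd (f n)))))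
      \<le> limsup (\<lambda>n. ennreal (\<epsilon> + inverse (real (Suc n))))"
    using f by (intro Limsup_mono always_eventually allI ennreal_leI) (simp add: P_def)
  moreover have "strict_mono (\<lambda>n. fst (f n))" "strict_mono (\<lambda>n. snd (f n))"
    using step by (auto simp: strict_mono_Suc_iff)
  ultimately obtain N where "\<forall>n\<ge>N. dist (x (fst (f n) + \<nu> n)) (x (snd (f n) + \<nu> n)) \<le> \<epsilon>"
    using \<nu>[of "\<lambda>n. fst (f n)" "\<lambda>n. snd (f n)"] by auto
  then show False using f[of N] by (force simp: P_def)
qed

end
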